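(* Let $(M,g)$ be a compact Riemannian manifold without boundary and let $\{e_j\}_{j\in\mathbb N}$ be an orthonormal basis of $L^2(M)$ with $\Delta_g e_j=-\lambda_j^2e_j$, $\lambda_j\ge0$. Let $S$ be a finite subset of the set of eigenvalues of $\sqrt{-\Delta_g}$ and let $X_S=\{j:\lambda_j\in S\}$. Suppose that $f\in L^2(M)$ is not identically $0$ and is $L^2$-concentrated in $E\subset M$ at level $L$ with respect to the Riemannian volume density, and that $\widehat f$ is $L^2$-concentrated on $X_S$ at level $L'$ with respect to the counting measure. Then $$(1-\epsilon-\epsilon')^2\le|E|\left(\sup_{x\in M}\sum_{\lambda_j\in S}|e_j(x)|^2\right),$$ where $L=(1-\epsilon^2)^{-1/2}$ and $L'=(1-\epsilon'^2)^{-1/2}$ with $\epsilon,\epsilon'\in[0,1)$.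
   Context: $\Delta_g$ is the Laplace–Beltrami operator (negative semi-definite sign convention), and $|E|$ is the Riemannian volume of $E$. The eigenvalues $\lambda_j$ of $\sqrt{-\Delta_g}$ are listed with multiplicity, $0=\lambda_1\le\lambda_2\le\cdots\to\infty$; the sum over $\lambda_j\in S$ means the sum over all $j\in X_S$. The Fourier coefficients of $f$ are $\widehat f(j)=\int_M f\,\overline{e_j}\,dV_g$, viewed as a function on $\mathbb N$. Concentration: if $X$ is a measure space with measure $\mu$ and $E\subset X$, a function $f\in L^p(X,\mu)$ is $L^p$-concentrated on (in) $E$ at level $L\ge1$ if $\left(\int_X|f|^p\,d\mu\right)^{1/p}\le L\left(\int_E|f|^p\,d\mu\right)^{1/p}$.
   Formalization: The formal theorem additionally assumes ε+ε' ≤ 1; for ε+ε' > 1 the inequality as written can fail (e.g. on a circle with S={0}, ε=ε'=1/√2, E a short arc), since the square of the negative number 1−ε−ε' is positive. *)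

theory Defs
  imports "HOL-Analysis.Analysis"
begin

section \<open>Smooth maps between open subsets of Euclidean spaces\<close>

primrec Ck_on ::
    "nat \<Rightarrow> 'a::real_normed_vector set \<Rightarrow> ('a \<Rightarrow> 'b::real_normed_vector) \<Rightarrow> bool" where
  "Ck_on 0 U f \<longleftrightarrow> continuous_on U f"
| "Ck_on (Suc k) U f \<longleftrightarrow>
     (\<forall>x\<in>U. f differentiable (at x)) \<and>
     (\<forall>v. Ck_on k U (\<lambda>x. frechet_derivative f (at x) v))"

definition smooth_on :: "'a::real_normed_vector set \<Rightarrow> ('a \<Rightarrow> 'b::real_normed_vector) \<Rightarrow> bool" where
  "smooth_on U f \<longleftrightarrow> (\<forall>k. Ck_on k U f)"

definition partial :: "'n \<Rightarrow> (real ^ 'n \<Rightarrow> 'b::real_normed_vector) \<Rightarrow> real ^ 'n::finite \<Rightarrow> 'b" where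
  "partial i f y = frechet_derivative f (at y) (axis i 1)"


section \<open>Smooth manifolds given by an atlas\<close>

text \<open>The manifold is the whole type \<open>'m\<close>. A chart is a pair \<open>(U, \<phi>)\<close> of a domain and a
  coordinate map; the values of \<open>\<phi>\<close> outside \<open>U\<close> are irrelevant.\<close>

type_synonym ('m, 'n) chart = "'m set \<times> ('m \<Rightarrow> real ^ 'n)"

definition chart_inv :: "('m, 'n) chart \<Rightarrow> real ^ 'n \<Rightarrow> 'm" where
  "chart_inv c = inv_into (fst c) (snd c)"

definition chart_image :: "('m, 'n) chart \<Rightarrow> (real ^ 'n) set" where
  "chart_image c = snd c ` fst c"

definition transition :: "('m, 'n) chart \<Rightarrow> ('m, 'n) chart \<Rightarrow> real ^ 'n \<Rightarrow> real ^ 'n" where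
  "transition c d = snd d \<circ> chart_inv c"

definition smooth_atlas :: "('m::topological_space, 'n::finite) chart set \<Rightarrow> bool" where
  "smooth_atlas A \<longleftrightarrow>
     (\<Union>c\<in>A. fst c) = UNIV \<and>
     (\<forall>c\<in>A. open (fst c) \<and> open (chart_image c) \<and>
        homeomorphism (fst c) (chart_image c) (snd c) (chart_inv c)) \<and>
     (\<forall>c\<in>A. \<forall>d\<in>A. smooth_on (snd c ` (fst c \<inter> fst d)) (transition c d))"

definition smooth_function ::
    "('m, 'n::finite) chart set \<Rightarrow> ('m \<Rightarrow> 'b::real_normed_vector) \<Rightarrow> bool" where
  "smooth_function A u \<longleftrightarrow> (\<forall>c\<in>A. smooth_on (chart_image c) (u \<circ> chart_inv c))"


section \<open>Riemannian metrics, volume and the Laplace--Beltrami operator\<close>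

text \<open>A metric is given by its Gram matrices: \<open>g c y\<close> is the matrix \<open>(g\<^sub>i\<^sub>j)\<close> in the chart \<open>c\<close>
  at the point with coordinates \<open>y\<close>. The last clause is the transformation law of a covariant
  2-tensor.\<close>

type_synonym ('m, 'n) metric = "('m, 'n) chart \<Rightarrow> real ^ 'n \<Rightarrow> real ^ 'n ^ 'n"

definition riemannian_metric ::
    "('m, 'n::finite) chart set \<Rightarrow> ('m, 'n) metric \<Rightarrow> bool" where
  "riemannian_metric A g \<longleftrightarrow>
     (\<forall>c\<in>A. smooth_on (chart_image c) (g c) \<and>
        (\<forall>y\<in>chart_image c. transpose (g c y) = g c y \<and>
           (\<forall>v. v \<noteq> 0 \<longrightarrow> 0 < v \<bullet> (g c y *v v)))) \<and>
     (\<forall>c\<in>A. \<forall>d\<in>A. \<forall>y\<in>snd c ` (fst c \<inter> fst d).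
        let J = matrix (frechet_derivative (transition c d) (at y))
        in g c y = transpose J ** g d (transition c d y) ** J)"

definition compact_riemannian_manifold ::
    "('m::{t2_space, second_countable_topology}, 'n::finite) chart set \<Rightarrow> ('m, 'n) metric \<Rightarrow> bool"
  where
  "compact_riemannian_manifold A g \<longleftrightarrow>
     compact (UNIV :: 'm set) \<and> smooth_atlas A \<and> riemannian_metric A g"

text \<open>The Borel measure with \<open>dV\<^sub>g = \<surd>(det g) dy\<close> in every chart (unique, since the manifold is
  covered by countably many charts), completed so that all Lebesgue measurable sets are
  measurable.\<close>

definition riemannian_volume ::
    "('m::topological_space, 'n::finite) chart set \<Rightarrow> ('m, 'n) metric \<Rightarrow> 'm measure \<Rightarrow> bool" where
  "riemannian_volume A g V \<longleftrightarrow>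
     (\<exists>\<mu>. V = completion \<mu> \<and> sets \<mu> = sets borel \<and>
        (\<forall>c\<in>A. \<forall>B\<in>sets borel. B \<subseteq> fst c \<longrightarrow>
           emeasure \<mu> B = (\<integral>\<^sup>+ y\<in>snd c ` B. ennreal (sqrt (det (g c y))) \<partial>lborel)))"

text \<open>\<open>\<Delta> u = |g|\<^sup>-\<^sup>1\<^sup>/\<^sup>2 \<Sum>\<^sub>i\<^sub>j \<partial>\<^sub>i (|g|\<^sup>1\<^sup>/\<^sup>2 g\<^sup>i\<^sup>j \<partial>\<^sub>j u)\<close> in the coordinates of \<open>c\<close>.\<close>

definition chart_laplacian ::
    "('m, 'n::finite) metric \<Rightarrow> ('m, 'n) chart \<Rightarrow> ('m \<Rightarrow> complex) \<Rightarrow> real ^ 'n \<Rightarrow> complex" where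
  "chart_laplacian g c u y =
     (1 / sqrt (det (g c y))) *\<^sub>R
     (\<Sum>i\<in>UNIV. \<Sum>j\<in>UNIV.
        partial i (\<lambda>z. (sqrt (det (g c z)) * matrix_inv (g c z) $ i $ j) *\<^sub>R
                        partial j (u \<circ> chart_inv c) z) y)"

text \<open>For smooth \<open>u\<close> the value does not depend on the chart chosen around \<open>p\<close>.\<close>

definition laplace_beltrami ::
    "('m, 'n::finite) chart set \<Rightarrow> ('m, 'n) metric \<Rightarrow> ('m \<Rightarrow> complex) \<Rightarrow> 'm \<Rightarrow> complex" where
  "laplace_beltrami A g u p =
     (let c = (SOME c. c \<in> A \<and> p \<in> fst c) in chart_laplacian g c u (snd c p))"

definition sqrt_laplacian_eigenfunction ::
    "('m, 'n::finite) chart set \<Rightarrow> ('m, 'n) metric \<Rightarrow> real \<Rightarrow> ('m \<Rightarrow> complex) \<Rightarrow> bool" where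
  "sqrt_laplacian_eigenfunction A g l u \<longleftrightarrow>
     0 \<le> l \<and> smooth_function A u \<and> (\<exists>p. u p \<noteq> 0) \<and>
     (\<forall>p. laplace_beltrami A g u p = - complex_of_real (l\<^sup>2) * u p)"

definition sqrt_laplacian_eigenvalues ::
    "('m, 'n::finite) chart set \<Rightarrow> ('m, 'n) metric \<Rightarrow> real set" where
  "sqrt_laplacian_eigenvalues A g = {l. \<exists>u. sqrt_laplacian_eigenfunction A g l u}"


section \<open>Lebesgue spaces, orthonormal bases and concentration\<close>

definition Lp_space :: "real \<Rightarrow> 'a measure \<Rightarrow> ('a \<Rightarrow> complex) set" where
  "Lp_space p \<mu> = {f \<in> borel_measurable \<mu>. integrable \<mu> (\<lambda>x. cmod (f x) powr p)}"

definition L2_inner :: "'a measure \<Rightarrow> ('a \<Rightarrow> complex) \<Rightarrow> ('a \<Rightarrow> complex) \<Rightarrow> complex" where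
  "L2_inner \<mu> f h = (LINT x|\<mu>. f x * cnj (h x))"

text \<open>An orthonormal sequence whose finite linear combinations are dense in \<open>L\<^sup>2\<close>.\<close>

definition L2_orthonormal_basis :: "'a measure \<Rightarrow> (nat \<Rightarrow> 'a \<Rightarrow> complex) \<Rightarrow> bool" where
  "L2_orthonormal_basis \<mu> e \<longleftrightarrow>
     (\<forall>j. e j \<in> Lp_space 2 \<mu>) \<and>
     (\<forall>i j. L2_inner \<mu> (e i) (e j) = (if i = j then 1 else 0)) \<and>
     (\<forall>f\<in>Lp_space 2 \<mu>. \<forall>\<delta>>0. \<exists>N a.
        sqrt (LINT x|\<mu>. (cmod (f x - (\<Sum>j<N. a j * e j x)))\<^sup>2) < \<delta>)"

definition fourier_coeff ::
    "'a measure \<Rightarrow> (nat \<Rightarrow> 'a \<Rightarrow> complex) \<Rightarrow> ('a \<Rightarrow> complex) \<Rightarrow> nat \<Rightarrow> complex" where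
  "fourier_coeff \<mu> e f j = L2_inner \<mu> f (e j)"

definition Lp_concentrated ::
    "real \<Rightarrow> 'a measure \<Rightarrow> 'a set \<Rightarrow> real \<Rightarrow> ('a \<Rightarrow> complex) \<Rightarrow> bool" where
  "Lp_concentrated p \<mu> E L f \<longleftrightarrow>
     f \<in> Lp_space p \<mu> \<and> E \<in> sets \<mu> \<and> 1 \<le> L \<and>
     (LINT x|\<mu>. cmod (f x) powr p) powr (1 / p)
       \<le> L * (LINT x:E|\<mu>. cmod (f x) powr p) powr (1 / p)"

end

theory Submission
  imports Defs
begin

text \<open>Let \<open>P\<close> be the orthogonal projection onto the span of the \<open>e\<^sub>j\<close> with
  \<open>j \<in> X\<^sub>S\<close>. By Parseval, concentration of the Fourier coefficients means
  \<open>\<parallel>f - P f\<parallel> \<le> \<epsilon>' \<parallel>f\<parallel>\<close>, while concentration of \<open>f\<close> gives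
  \<open>\<parallel>f\<parallel>\<^sub>E \<ge> (1 - \<epsilon>\<^sup>2)\<^sup>1\<^sup>/\<^sup>2 \<parallel>f\<parallel> \<ge> (1 - \<epsilon>) \<parallel>f\<parallel>\<close> for the \<open>L\<^sup>2\<close> norm
  on \<open>E\<close>. Hence \<open>\<parallel>P f\<parallel>\<^sub>E \<ge> (1 - \<epsilon> - \<epsilon>') \<parallel>f\<parallel>\<close>. On the other hand, Cauchy-Schwarz and Bessel
  bound \<open>\<bar>P f x\<bar>\<^sup>2\<close> pointwise by \<open>\<parallel>f\<parallel>\<^sup>2 \<Sum> \<bar>e\<^sub>j x\<bar>\<^sup>2\<close>, and integrating over \<open>E\<close> concludes.\<close>

section \<open>Closure properties of square-integrable functions\<close>

lemma Lp_space_2_iff: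
  "f \<in> Lp_space 2 M \<longleftrightarrow> f \<in> borel_measurable M \<and> integrable M (\<lambda>x. (cmod (f x))\<^sup>2)"
  by (simp add: Lp_space_def)

text \<open>Domination by |f|^2 + |h|^2 makes the integrand of \<open>L2_inner\<close> integrable,
  so the linearity rules below never meet the default value 0 of a non-integrable function.\<close>

lemma Lp_space_2_integrable_mult_cnj:
  assumes "f \<in> Lp_space 2 M" "h \<in> Lp_space 2 M"
  shows "integrable M (\<lambda>x. f x * cnj (h x))"
proof (rule Bochner_Integration.integrable_bound)
  show "integrable M (\<lambda>x. (cmod (f x))\<^sup>2 + (cmod (h x))\<^sup>2)"
    using assms by (simp add: Lp_space_2_iff)
  have [measurable]: "f \<in> borel_measurable M" "h \<in> borel_measurable M"
    using assms by (simp_all add: Lp_space_2_iff)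
  show "(\<lambda>x. f x * cnj (h x)) \<in> borel_measurable M"
    by (intro borel_measurable_times measurable_compose[of h M borel cnj]
        borel_measurable_continuous_onI continuous_intros) simp_all
  have "a * b \<le> a\<^sup>2 + b\<^sup>2" for a b :: real
    using sum_squares_bound[of a b] zero_le_power2[of a] zero_le_power2[of b]
    by linarith
  then show "AE x in M. norm (f x * cnj (h x)) \<le> norm ((cmod (f x))\<^sup>2 + (cmod (h x))\<^sup>2)"
    by (simp add: norm_mult)
qed

lemma Lp_space_2_cmult:
  assumes "f \<in> Lp_space 2 M"
  shows "(\<lambda>x. c * f x) \<in> Lp_space 2 M"
  using assms
  by (simp add: Lp_space_2_iff norm_mult power_mult_distrib borel_measurable_times borel_measurable_const)

lemma Lp_space_2_add:
  assumes "f \<in> Lp_space 2 M" "h \<in> Lp_space 2 M"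
  shows "(\<lambda>x. f x + h x) \<in> Lp_space 2 M"
proof -
  have [measurable]: "f \<in> borel_measurable M" "h \<in> borel_measurable M"
    using assms by (simp_all add: Lp_space_2_iff)
  have "integrable M (\<lambda>x. (cmod (f x + h x))\<^sup>2)"
  proof (rule Bochner_Integration.integrable_bound)
    show "integrable M (\<lambda>x. 2 * (cmod (f x))\<^sup>2 + 2 * (cmod (h x))\<^sup>2)"
      using assms by (simp add: Lp_space_2_iff)
    have "(cmod (a + b))\<^sup>2 \<le> 2 * (cmod a)\<^sup>2 + 2 * (cmod b)\<^sup>2" for a b
    proof -
      have "(cmod (a + b))\<^sup>2 \<le> (cmod a + cmod b)\<^sup>2"
        by (simp add: norm_triangle_ineq power_mono)
      also have "\<dots> \<le> 2 * (cmod a)\<^sup>2 + 2 * (cmod b)\<^sup>2"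
        using sum_squares_bound[of "cmod a" "cmod b"] by (simp add: power2_sum)
      finally show ?thesis .
    qed
    then show "AE x in M. norm ((cmod (f x + h x))\<^sup>2) \<le> norm (2 * (cmod (f x))\<^sup>2 + 2 * (cmod (h x))\<^sup>2)"
      by simp
  qed simp
  then show ?thesis
    by (simp add: Lp_space_2_iff)
qed

lemma Lp_space_2_diff:
  assumes "f \<in> Lp_space 2 M" "h \<in> Lp_space 2 M"
  shows "(\<lambda>x. f x - h x) \<in> Lp_space 2 M"
  using Lp_space_2_add[OF assms(1) Lp_space_2_cmult[OF assms(2), of "-1"]] by simp

lemma Lp_space_2_sum:
  assumes "finite F" "\<And>j. j \<in> F \<Longrightarrow> u j \<in> Lp_space 2 M"
  shows "(\<lambda>x. \<Sum>j\<in>F. u j x) \<in> Lp_space 2 M"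
  using assms
proof (induction F)
  case empty
  then show ?case by (simp add: Lp_space_2_iff)
next
  case (insert j F)
  then show ?case by (simp add: Lp_space_2_add)
qed

section \<open>Inner products, Bessel and Parseval\<close>

lemma L2_inner_self:
  "L2_inner M f f = of_real (LINT x|M. (cmod (f x))\<^sup>2)"
  unfolding L2_inner_def complex_norm_square[symmetric] by (rule integral_complex_of_real)

lemma cnj_L2_inner: "cnj (L2_inner M f h) = L2_inner M h f"
  unfolding L2_inner_def Bochner_Integration.integral_cnj[symmetric] by (simp add: mult.commute)

lemma L2_inner_diff_left:
  assumes "f \<in> Lp_space 2 M" "g \<in> Lp_space 2 M" "h \<in> Lp_space 2 M"
  shows "L2_inner M (\<lambda>x. f x - g x) h = L2_inner M f h - L2_inner M g h"
  unfolding L2_inner_def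
  using assms by (simp add: left_diff_distrib Lp_space_2_integrable_mult_cnj)

lemma L2_inner_diff_right:
  assumes "f \<in> Lp_space 2 M" "g \<in> Lp_space 2 M" "h \<in> Lp_space 2 M"
  shows "L2_inner M h (\<lambda>x. f x - g x) = L2_inner M h f - L2_inner M h g"
  unfolding L2_inner_def
  using assms by (simp add: right_diff_distrib Lp_space_2_integrable_mult_cnj)

lemma L2_inner_sum_right:
  assumes "\<And>j. j \<in> F \<Longrightarrow> u j \<in> Lp_space 2 M" "h \<in> Lp_space 2 M"
  shows "L2_inner M h (\<lambda>x. \<Sum>j\<in>F. a j * u j x) = (\<Sum>j\<in>F. cnj (a j) * L2_inner M h (u j))"
proof -
  have "L2_inner M h (\<lambda>x. \<Sum>j\<in>F. a j * u j x)
      = (LINT x|M. (\<Sum>j\<in>F. cnj (a j) * (h x * cnj (u j x))))"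
    by (simp add: L2_inner_def sum_distrib_left mult_ac)
  also have "\<dots> = (\<Sum>j\<in>F. (LINT x|M. cnj (a j) * (h x * cnj (u j x))))"
    using assms by (intro Bochner_Integration.integral_sum) (simp add: Lp_space_2_integrable_mult_cnj)
  finally show ?thesis
    by (simp add: L2_inner_def)
qed

lemma L2_orthonormal_basis_Lp_space:
  "L2_orthonormal_basis M e \<Longrightarrow> e j \<in> Lp_space 2 M"
  by (simp add: L2_orthonormal_basis_def)

text \<open>Expand the square by orthonormality and complete it in the coefficients
  \<open>a j\<close>. Taking \<open>a\<close> to be the Fourier coefficients gives Bessel and the
  projection error; arbitrary \<open>a\<close> serves for Parseval.\<close>

lemma L2_distance_to_combination:
  assumes e: "L2_orthonormal_basis M e" and f: "f \<in> Lp_space 2 M" and F: "finite F"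
  shows "(LINT x|M. (cmod (f x - (\<Sum>j\<in>F. a j * e j x)))\<^sup>2)
    = (LINT x|M. (cmod (f x))\<^sup>2) - (\<Sum>j\<in>F. (cmod (fourier_coeff M e f j))\<^sup>2)
      + (\<Sum>j\<in>F. (cmod (a j - fourier_coeff M e f j))\<^sup>2)"
proof -
  define s where "s = (\<lambda>x. \<Sum>j\<in>F. a j * e j x)"
  note eL = L2_orthonormal_basis_Lp_space[OF e]
  have s: "s \<in> Lp_space 2 M"
    unfolding s_def by (intro Lp_space_2_sum F Lp_space_2_cmult eL)
  have orth: "L2_inner M (e i) (e j) = (if i = j then 1 else 0)" for i j
    using e by (simp add: L2_orthonormal_basis_def)
  have fs: "L2_inner M f s = (\<Sum>j\<in>F. cnj (a j) * fourier_coeff M e f j)"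
    unfolding s_def fourier_coeff_def by (rule L2_inner_sum_right[OF eL f])
  have sf: "L2_inner M s f = (\<Sum>j\<in>F. a j * cnj (fourier_coeff M e f j))"
    unfolding cnj_L2_inner[of M f s, symmetric] fs by simp
  have es: "L2_inner M (e i) s = (if i \<in> F then cnj (a i) else 0)" for i
    unfolding s_def by (subst L2_inner_sum_right[OF eL eL]) (simp add: orth F if_distrib cong: if_cong)
  have se: "L2_inner M s (e i) = (if i \<in> F then a i else 0)" for i
    unfolding cnj_L2_inner[of M "e i" s, symmetric] es by simp
  have ss: "L2_inner M s s = (\<Sum>j\<in>F. cnj (a j) * a j)"
  proof -
    have "L2_inner M s s = (\<Sum>j\<in>F. cnj (a j) * L2_inner M s (e j))"
      using L2_inner_sum_right[OF eL s, where F = F and a = a] by (simp add: s_def)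
    then show ?thesis by (simp add: se)
  qed
  have fs_L: "(\<lambda>x. f x - s x) \<in> Lp_space 2 M"
    by (rule Lp_space_2_diff[OF f s])
  have "complex_of_real (LINT x|M. (cmod (f x - s x))\<^sup>2) = L2_inner M (\<lambda>x. f x - s x) (\<lambda>x. f x - s x)"
    by (simp add: L2_inner_self)
  also have "\<dots> = L2_inner M f f - L2_inner M f s - (L2_inner M s f - L2_inner M s s)"
    by (simp only: L2_inner_diff_left[OF f s fs_L] L2_inner_diff_right[OF f s f]
        L2_inner_diff_right[OF f s s])
  \<comment> \<open>With c_j the Fourier coefficient, |c_j|^2 is subtracted and added back, so that
    the cross terms and |a_j|^2 combine into |a_j - c_j|^2.\<close>
  also have "\<dots> = L2_inner M f f - (\<Sum>j\<in>F. fourier_coeff M e f j * cnj (fourier_coeff M e f j))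
      + (\<Sum>j\<in>F. (a j - fourier_coeff M e f j) * cnj (a j - fourier_coeff M e f j))"
    unfolding fs sf ss
    by (simp add: algebra_simps sum.distrib sum_subtractf)
  also have "\<dots> = complex_of_real ((LINT x|M. (cmod (f x))\<^sup>2)
      - (\<Sum>j\<in>F. (cmod (fourier_coeff M e f j))\<^sup>2)
      + (\<Sum>j\<in>F. (cmod (a j - fourier_coeff M e f j))\<^sup>2))"
    unfolding L2_inner_self complex_norm_square[symmetric] by simp
  finally show ?thesis
    unfolding s_def of_real_eq_iff .
qed

text \<open>The squared distance from \<open>f\<close> to its projection is nonnegative.\<close>

lemma Bessel_inequality:
  assumes "L2_orthonormal_basis M e" "f \<in> Lp_space 2 M" "finite F"
  shows "(\<Sum>j\<in>F. (cmod (fourier_coeff M e f j))\<^sup>2) \<le> (LINT x|M. (cmod (f x))\<^sup>2)"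
proof -
  have "0 \<le> (LINT x|M. (cmod (f x - (\<Sum>j\<in>F. fourier_coeff M e f j * e j x)))\<^sup>2)"
    by (rule integral_nonneg_AE) simp
  then show ?thesis
    using L2_distance_to_combination[OF assms, of "fourier_coeff M e f"] by simp
qed

text \<open>This is the half of Parseval that rests on density: some combination comes within
  \<open>d\<close> in squared distance, and by the distance identity no choice of coefficients beats
  the Fourier coefficients.\<close>

lemma Parseval_le:
  assumes e: "L2_orthonormal_basis M e" and f: "f \<in> Lp_space 2 M"
    and sm: "summable (\<lambda>j. (cmod (fourier_coeff M e f j))\<^sup>2)"
  shows "(LINT x|M. (cmod (f x))\<^sup>2) \<le> (\<Sum>j. (cmod (fourier_coeff M e f j))\<^sup>2)"
proof (rule field_le_epsilon)
  fix d :: real assume "d > 0"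
  \<comment> \<open>Density is phrased in terms of the norm, the distance identity in terms of its
    square; hence the tolerance \<open>sqrt d\<close>.\<close>
  then have "sqrt d > 0" by simp
  then obtain N a where "sqrt (LINT x|M. (cmod (f x - (\<Sum>j<N. a j * e j x)))\<^sup>2) < sqrt d"
    using e f unfolding L2_orthonormal_basis_def by blast
  then have "(LINT x|M. (cmod (f x - (\<Sum>j<N. a j * e j x)))\<^sup>2) < d"
    by simp
  moreover have "(\<Sum>j<N. (cmod (a j - fourier_coeff M e f j))\<^sup>2) \<ge> 0"
    by (simp add: sum_nonneg)
  moreover have "(\<Sum>j<N. (cmod (fourier_coeff M e f j))\<^sup>2) \<le> (\<Sum>j. (cmod (fourier_coeff M e f j))\<^sup>2)"
    by (rule sum_le_suminf[OF sm]) auto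
  ultimately show "(LINT x|M. (cmod (f x))\<^sup>2) \<le> (\<Sum>j. (cmod (fourier_coeff M e f j))\<^sup>2) + d"
    using L2_distance_to_combination[OF e f, of "{..<N}" a] by simp
qed

section \<open>Cauchy-Schwarz and the triangle inequality for integrals\<close>

lemma L2_inner_norm_le:
  assumes "f \<in> Lp_space 2 M" "h \<in> Lp_space 2 M"
  shows "(LINT x|M. cmod (f x) * cmod (h x))
    \<le> sqrt (LINT x|M. (cmod (f x))\<^sup>2) * sqrt (LINT x|M. (cmod (h x))\<^sup>2)"
proof -
  have [measurable]: "f \<in> borel_measurable M" "h \<in> borel_measurable M"
    and f: "integrable M (\<lambda>x. (cmod (f x))\<^sup>2)" and h: "integrable M (\<lambda>x. (cmod (h x))\<^sup>2)"
    using assms by (simp_all add: Lp_space_2_iff)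
  have fh: "integrable M (\<lambda>x. cmod (f x) * cmod (h x))"
    using integrable_norm[OF Lp_space_2_integrable_mult_cnj[OF assms]] by (simp add: norm_mult)
  \<comment> \<open>Cauchy-Schwarz is applied to nonnegative integrals; integrability of both
    squares and of the product then carries it back to real-valued integrals.\<close>
  have "(\<integral>\<^sup>+x. ennreal (cmod (f x)) * ennreal (cmod (h x)) \<partial>M)\<^sup>2
      \<le> (\<integral>\<^sup>+x. (ennreal (cmod (f x)))\<^sup>2 \<partial>M) * (\<integral>\<^sup>+x. (ennreal (cmod (h x)))\<^sup>2 \<partial>M)"
    by (rule Cauchy_Schwarz_nn_integral) auto
  then have "(LINT x|M. cmod (f x) * cmod (h x))\<^sup>2
      \<le> (LINT x|M. (cmod (f x))\<^sup>2) * (LINT x|M. (cmod (h x))\<^sup>2)"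
    using f h fh
    by (simp add: ennreal_power nn_integral_eq_integral integral_nonneg_AE
        flip: ennreal_mult)
  then show ?thesis
    by (simp add: real_le_rsqrt flip: real_sqrt_mult)
qed

text \<open>After squaring, the only term to estimate is the cross term, which Cauchy-Schwarz
  bounds.\<close>

lemma L2_triangle:
  assumes f: "f \<in> Lp_space 2 M" and h: "h \<in> Lp_space 2 M"
  shows "sqrt (LINT x|M. (cmod (f x + h x))\<^sup>2)
    \<le> sqrt (LINT x|M. (cmod (f x))\<^sup>2) + sqrt (LINT x|M. (cmod (h x))\<^sup>2)"
proof (rule real_le_lsqrt)
  have fh: "integrable M (\<lambda>x. cmod (f x) * cmod (h x))"
    using integrable_norm[OF Lp_space_2_integrable_mult_cnj[OF f h]] by (simp add: norm_mult)
  have f2: "integrable M (\<lambda>x. (cmod (f x))\<^sup>2)" and h2: "integrable M (\<lambda>x. (cmod (h x))\<^sup>2)"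
    using f h by (simp_all add: Lp_space_2_iff)
  have "(LINT x|M. (cmod (f x + h x))\<^sup>2)
      \<le> (LINT x|M. (cmod (f x))\<^sup>2 + (cmod (h x))\<^sup>2 + 2 * (cmod (f x) * cmod (h x)))"
  proof (rule integral_mono)
    show "integrable M (\<lambda>x. (cmod (f x + h x))\<^sup>2)"
      using Lp_space_2_add[OF f h] by (simp add: Lp_space_2_iff)
    show "(cmod (f x + h x))\<^sup>2 \<le> (cmod (f x))\<^sup>2 + (cmod (h x))\<^sup>2 + 2 * (cmod (f x) * cmod (h x))" for x
      using power_mono[OF norm_triangle_ineq[of "f x" "h x"], of 2] by (simp add: power2_sum)
  qed (use f2 h2 fh in simp)
  also have "\<dots> = (LINT x|M. (cmod (f x))\<^sup>2) + (LINT x|M. (cmod (h x))\<^sup>2)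
      + 2 * (LINT x|M. cmod (f x) * cmod (h x))"
    using f2 h2 fh by simp
  also have "\<dots> \<le> (sqrt (LINT x|M. (cmod (f x))\<^sup>2) + sqrt (LINT x|M. (cmod (h x))\<^sup>2))\<^sup>2"
    using L2_inner_norm_le[OF f h] by (simp add: power2_sum integral_nonneg_AE)
  finally show "(LINT x|M. (cmod (f x + h x))\<^sup>2)
      \<le> (sqrt (LINT x|M. (cmod (f x))\<^sup>2) + sqrt (LINT x|M. (cmod (h x))\<^sup>2))\<^sup>2" .
qed (simp add: integral_nonneg_AE)

section \<open>Consequences of concentration\<close>

lemma Lp_space_2_indicator:
  assumes "f \<in> Lp_space 2 M" "E \<in> sets M"
  shows "(\<lambda>x. indicator E x * f x) \<in> Lp_space 2 M"
proof -
  have "(cmod (indicator E x * f x))\<^sup>2 = indicator E x *\<^sub>R (cmod (f x))\<^sup>2" for x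
    by (auto split: split_indicator)
  then show ?thesis
    using assms integrable_mult_indicator[of E M "\<lambda>x. (cmod (f x))\<^sup>2"]
    by (simp add: Lp_space_2_iff borel_measurable_times borel_measurable_indicator)
qed

text \<open>The level is the reciprocal of sqrt(1 - t^2), so moving it to the left and squaring
  clears all roots. The lemma serves both the measure of \<open>f\<close> and the counting measure
  of its coefficients. The indicator form makes the restriction to \<open>E\<close> a member of
  \<open>Lp_space 2\<close>.\<close>

lemma L2_concentratedD:
  assumes c: "Lp_concentrated 2 M E ((1 - t\<^sup>2) powr (- 1 / 2)) f" and t: "t \<in> {0..<1}"
  shows "(1 - t\<^sup>2) * (LINT x|M. (cmod (f x))\<^sup>2) \<le> (LINT x|M. (cmod (indicator E x * f x))\<^sup>2)"
proof -
  define a where "a = (LINT x|M. (cmod (f x))\<^sup>2)"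
  define b where "b = (LINT x|M. (cmod (indicator E x * f x))\<^sup>2)"
  have b_eq: "(LINT x:E|M. (cmod (f x))\<^sup>2) = b"
    unfolding b_def set_lebesgue_integral_def
    by (intro Bochner_Integration.integral_cong) (auto split: split_indicator)
  have ab: "a \<ge> 0" "b \<ge> 0"
    by (simp_all add: a_def b_def integral_nonneg_AE)
  have t1: "0 < 1 - t\<^sup>2"
    using t by (simp add: power_less_one_iff abs_square_less_1)
  have "(1 - t\<^sup>2) powr (- 1 / 2) = 1 / sqrt (1 - t\<^sup>2)"
    using t1 by (simp add: powr_minus_divide powr_half_sqrt)
  then have "sqrt a \<le> 1 / sqrt (1 - t\<^sup>2) * sqrt b"
    using c ab unfolding Lp_concentrated_def
    by (simp add: powr_half_sqrt b_eq a_def[symmetric])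
  then have "sqrt (1 - t\<^sup>2) * sqrt a \<le> sqrt b"
    using t1 by (simp add: field_simps)
  then have "sqrt ((1 - t\<^sup>2) * a) \<le> sqrt b"
    by (simp only: real_sqrt_mult)
  then show ?thesis
    by (simp add: a_def b_def)
qed

text \<open>By Parseval and concentration, the coefficients in \<open>X\<close> carry at least the
  fraction 1 - t^2 of the squared norm of \<open>f\<close>; what the projection misses is the
  remaining fraction.\<close>

lemma L2_projection_error:
  assumes e: "L2_orthonormal_basis M e" and f: "f \<in> Lp_space 2 M" and X: "finite X"
    and c: "Lp_concentrated 2 (count_space UNIV) X ((1 - t\<^sup>2) powr (- 1 / 2)) (fourier_coeff M e f)"
    and t: "t \<in> {0..<1}"
  shows "(LINT x|M. (cmod (f x - (\<Sum>j\<in>X. fourier_coeff M e f j * e j x)))\<^sup>2)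
    \<le> t\<^sup>2 * (LINT x|M. (cmod (f x))\<^sup>2)"
proof -
  let ?c = "fourier_coeff M e f"
  let ?n = "LINT x|M. (cmod (f x))\<^sup>2"
  have int: "integrable (count_space UNIV) (\<lambda>j. (cmod (?c j))\<^sup>2)"
    using c by (simp add: Lp_concentrated_def Lp_space_2_iff)
  then have "summable (\<lambda>j. (cmod (?c j))\<^sup>2)"
    by (simp add: integrable_count_space_nat_iff)
  then have "?n \<le> (LINT j|count_space UNIV. (cmod (?c j))\<^sup>2)"
    using Parseval_le[OF e f] int by (simp add: integral_count_space_nat)
  then have "(1 - t\<^sup>2) * ?n \<le> (1 - t\<^sup>2) * (LINT j|count_space UNIV. (cmod (?c j))\<^sup>2)"
    using t by (intro mult_left_mono) (simp_all add: power_le_one)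
  also have "\<dots> \<le> (LINT j|count_space UNIV. (cmod (indicator X j * ?c j))\<^sup>2)"
    by (rule L2_concentratedD[OF c t])
  also have "\<dots> = (LINT j:X|count_space UNIV. (cmod (?c j))\<^sup>2)"
    unfolding set_lebesgue_integral_def
    by (intro Bochner_Integration.integral_cong) (auto split: split_indicator)
  also have "\<dots> = (LINT j|count_space X. (cmod (?c j))\<^sup>2)"
    unfolding set_lebesgue_integral_def
    by (subst integral_restrict_space[symmetric]) (auto simp: restrict_count_space)
  also have "\<dots> = (\<Sum>j\<in>X. (cmod (?c j))\<^sup>2)"
    by (rule lebesgue_integral_count_space_finite[OF X])
  \<comment> \<open>With the Fourier coefficients as \<open>a\<close>, the last sum of the distance
    identity vanishes.\<close>
  finally show ?thesis
    using L2_distance_to_combination[OF e f X, of ?c] by (simp add: algebra_simps)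
qed

lemma norm_sum_mult_squared_le:
  fixes a b :: "'i \<Rightarrow> complex"
  shows "(cmod (\<Sum>j\<in>F. a j * b j))\<^sup>2 \<le> (\<Sum>j\<in>F. (cmod (a j))\<^sup>2) * (\<Sum>j\<in>F. (cmod (b j))\<^sup>2)"
proof -
  have "cmod (\<Sum>j\<in>F. a j * b j) \<le> (\<Sum>j\<in>F. cmod (a j) * cmod (b j))"
    using norm_sum[of "\<lambda>j. a j * b j" F] by (simp add: norm_mult)
  then have "(cmod (\<Sum>j\<in>F. a j * b j))\<^sup>2 \<le> (\<Sum>j\<in>F. cmod (a j) * cmod (b j))\<^sup>2"
    by (simp add: power_mono)
  also have "\<dots> \<le> (\<Sum>j\<in>F. (cmod (a j))\<^sup>2) * (\<Sum>j\<in>F. (cmod (b j))\<^sup>2)"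
    by (rule Cauchy_Schwarz_ineq_sum)
  finally show ?thesis .
qed

text \<open>Cauchy-Schwarz in the index \<open>j\<close> and Bessel bound the projection pointwise
  by a constant, which is then integrated over \<open>E\<close>. Working in \<open>ennreal\<close>
  gives meaning to the right-hand side even when the supremum or the measure of \<open>E\<close> is
  infinite.\<close>

lemma L2_projection_on_set_le:
  assumes e: "L2_orthonormal_basis M e" and f: "f \<in> Lp_space 2 M" and X: "finite X"
    and E: "E \<in> sets M"
  shows "ennreal (LINT x|M. (cmod (indicator E x * (\<Sum>j\<in>X. fourier_coeff M e f j * e j x)))\<^sup>2)
    \<le> ennreal (LINT x|M. (cmod (f x))\<^sup>2)
        * (emeasure M E * (SUP x. \<Sum>j\<in>X. ennreal ((cmod (e j x))\<^sup>2)))"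
    (is "ennreal (LINT x|M. ?p x) \<le> ennreal ?n * (_ * ?s)")
proof -
  have "(\<lambda>x. indicator E x * (\<Sum>j\<in>X. fourier_coeff M e f j * e j x)) \<in> Lp_space 2 M"
    by (intro Lp_space_2_indicator Lp_space_2_sum Lp_space_2_cmult X E
        L2_orthonormal_basis_Lp_space[OF e])
  then have "ennreal (LINT x|M. ?p x) = (\<integral>\<^sup>+x. ennreal (?p x) \<partial>M)"
    by (simp add: Lp_space_2_iff nn_integral_eq_integral)
  also have "\<dots> \<le> (\<integral>\<^sup>+x. (ennreal ?n * ?s) * indicator E x \<partial>M)"
  proof (rule nn_integral_mono)
    fix x
    have "(cmod (\<Sum>j\<in>X. fourier_coeff M e f j * e j x))\<^sup>2
        \<le> (\<Sum>j\<in>X. (cmod (fourier_coeff M e f j))\<^sup>2) * (\<Sum>j\<in>X. (cmod (e j x))\<^sup>2)"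
      by (rule norm_sum_mult_squared_le)
    also have "\<dots> \<le> ?n * (\<Sum>j\<in>X. (cmod (e j x))\<^sup>2)"
      by (intro mult_right_mono Bessel_inequality[OF e f X] sum_nonneg) simp
    finally have "ennreal ((cmod (\<Sum>j\<in>X. fourier_coeff M e f j * e j x))\<^sup>2)
        \<le> ennreal (?n * (\<Sum>j\<in>X. (cmod (e j x))\<^sup>2))"
      by (rule ennreal_leI)
    also have "\<dots> = ennreal ?n * (\<Sum>j\<in>X. ennreal ((cmod (e j x))\<^sup>2))"
      by (simp add: ennreal_mult integral_nonneg_AE sum_nonneg)
    also have "\<dots> \<le> ennreal ?n * ?s"
      by (intro mult_left_mono SUP_upper) auto
    finally show "ennreal (?p x) \<le> (ennreal ?n * ?s) * indicator E x"
      by (auto split: split_indicator)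
  qed
  also have "\<dots> = ennreal ?n * (emeasure M E * ?s)"
    using E by (subst nn_integral_cmult_indicator) (simp_all only: mult_ac)
  finally show ?thesis .
qed

text \<open>The analytic core, for an arbitrary measure \<open>M\<close> and a finite index set
  \<open>X\<close>; on the manifold \<open>X\<close> becomes the set of \<open>j\<close> with
  \<open>lam j\<close> in \<open>S\<close>.\<close>

theorem L2_uncertainty_principle:
  assumes e: "L2_orthonormal_basis M e" and X: "finite X"
    and nz: "\<not> (AE x in M. f x = 0)"
    and cf: "Lp_concentrated 2 M E ((1 - \<epsilon>\<^sup>2) powr (- 1 / 2)) f"
    and cX: "Lp_concentrated 2 (count_space UNIV) X ((1 - \<epsilon>'\<^sup>2) powr (- 1 / 2)) (fourier_coeff M e f)"
    and eps: "\<epsilon> \<in> {0..<1}" "\<epsilon>' \<in> {0..<1}" "\<epsilon> + \<epsilon>' \<le> 1"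
  shows "ennreal ((1 - \<epsilon> - \<epsilon>')\<^sup>2)
    \<le> emeasure M E * (SUP x. \<Sum>j\<in>X. ennreal ((cmod (e j x))\<^sup>2))"
proof -
  have f: "f \<in> Lp_space 2 M" and E: "E \<in> sets M"
    using cf by (simp_all add: Lp_concentrated_def)
  define P where "P = (\<lambda>x. \<Sum>j\<in>X. fourier_coeff M e f j * e j x)"
  define n where "n = (LINT x|M. (cmod (f x))\<^sup>2)"
  define b where "b = (LINT x|M. (cmod (indicator E x * P x))\<^sup>2)"
  have P: "P \<in> Lp_space 2 M"
    unfolding P_def by (intro Lp_space_2_sum Lp_space_2_cmult X L2_orthonormal_basis_Lp_space[OF e])
  have fP: "(\<lambda>x. f x - P x) \<in> Lp_space 2 M"
    by (rule Lp_space_2_diff[OF f P])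
  \<comment> \<open>Positivity of \<open>n\<close> is what permits cancelling it at the end.\<close>
  have "n \<noteq> 0"
    using f nz unfolding n_def by (subst integral_nonneg_eq_0_iff_AE) (simp_all add: Lp_space_2_iff)
  moreover have "n \<ge> 0" "b \<ge> 0"
    by (simp_all add: n_def b_def integral_nonneg_AE)
  ultimately have n: "n > 0" by simp
  have "(LINT x|M. (cmod (indicator E x * (f x - P x)))\<^sup>2) \<le> (LINT x|M. (cmod (f x - P x))\<^sup>2)"
    using fP Lp_space_2_indicator[OF fP E]
    by (intro integral_mono) (auto simp: Lp_space_2_iff split: split_indicator)
  also have "\<dots> \<le> \<epsilon>'\<^sup>2 * n"
    unfolding P_def n_def by (rule L2_projection_error[OF e f X cX eps(2)])
  finally have "sqrt (LINT x|M. (cmod (indicator E x * (f x - P x)))\<^sup>2) \<le> sqrt (\<epsilon>'\<^sup>2 * n)"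
    by simp
  then have d: "sqrt (LINT x|M. (cmod (indicator E x * (f x - P x)))\<^sup>2) \<le> \<epsilon>' * sqrt n"
    using eps by (simp add: real_sqrt_mult)
  \<comment> \<open>Equivalent to \<epsilon>^2 \<le> \<epsilon>. It trades the sharp constant sqrt(1
    - \<epsilon>^2) for the linear 1 - \<epsilon>, from which \<epsilon>' can be subtracted.\<close>
  have "(1 - \<epsilon>)\<^sup>2 \<le> 1 - \<epsilon>\<^sup>2"
    using eps mult_left_mono[of \<epsilon> 1 \<epsilon>] by (simp add: power2_eq_square algebra_simps)
  then have "(1 - \<epsilon>)\<^sup>2 * n \<le> (1 - \<epsilon>\<^sup>2) * n"
    using n by simp
  also have "\<dots> \<le> (LINT x|M. (cmod (indicator E x * f x))\<^sup>2)"
    unfolding n_def by (rule L2_concentratedD[OF cf eps(1)])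
  finally have "sqrt ((1 - \<epsilon>)\<^sup>2 * n) \<le> sqrt (LINT x|M. (cmod (indicator E x * f x))\<^sup>2)"
    by simp
  then have "(1 - \<epsilon>) * sqrt n \<le> sqrt (LINT x|M. (cmod (indicator E x * f x))\<^sup>2)"
    using eps by (simp add: real_sqrt_mult)
  \<comment> \<open>Splitting \<open>f\<close> on \<open>E\<close> into error and projection turns
    the triangle inequality into a lower bound for the projection.\<close>
  also have "\<dots> = sqrt (LINT x|M. (cmod (indicator E x * (f x - P x) + indicator E x * P x))\<^sup>2)"
    by (simp add: algebra_simps)
  also have "\<dots> \<le> sqrt (LINT x|M. (cmod (indicator E x * (f x - P x)))\<^sup>2) + sqrt b"
    unfolding b_def by (intro L2_triangle Lp_space_2_indicator fP P E)
  finally have "(1 - \<epsilon> - \<epsilon>') * sqrt n \<le> sqrt b"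
    using d by (simp add: algebra_simps)
  then have "((1 - \<epsilon> - \<epsilon>') * sqrt n)\<^sup>2 \<le> (sqrt b)\<^sup>2"
    \<comment> \<open>Squaring preserves the inequality because \<epsilon> + \<epsilon>' \<le> 1
      keeps the left side nonnegative.\<close>
    using eps n by (intro power_mono) simp_all
  then have "n * (1 - \<epsilon> - \<epsilon>')\<^sup>2 \<le> b"
    using n \<open>b \<ge> 0\<close> by (simp add: power_mult_distrib mult.commute)
  then have "ennreal n * ennreal ((1 - \<epsilon> - \<epsilon>')\<^sup>2) \<le> ennreal b"
    using n by (simp add: ennreal_leI flip: ennreal_mult)
  also have "\<dots> \<le> ennreal n * (emeasure M E * (SUP x. \<Sum>j\<in>X. ennreal ((cmod (e j x))\<^sup>2)))"
    unfolding b_def n_def P_def by (rule L2_projection_on_set_le[OF e f X E])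
  finally show ?thesis
    using n by (simp add: ennreal_mult_le_mult_iff)
qed

section \<open>Passage to the eigenfunctions on the manifold\<close>

text \<open>A divergent sequence eventually exceeds every element of \<open>S\<close>, so each
  eigenvalue has finite multiplicity and the projection is a finite sum.\<close>

lemma finite_vimage_filterlim_at_top:
  fixes lam :: "nat \<Rightarrow> real"
  assumes "filterlim lam at_top sequentially" "finite S"
  shows "finite {j. lam j \<in> S}"
proof -
  obtain B where B: "\<And>s. s \<in> S \<Longrightarrow> s < B"
    using bdd_above_finite[OF assms(2)] by (meson bdd_above_def gt_ex le_less_trans)
  obtain N where "\<And>j. j \<ge> N \<Longrightarrow> B \<le> lam j"
    using assms(1) by (auto simp: filterlim_at_top eventually_sequentially)
  with B have "{j. lam j \<in> S} \<subseteq> {..<N}"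
    by (force simp: not_le[symmetric])
  then show ?thesis
    by (rule finite_subset) simp
qed

theorem corollary1p10:
  fixes A :: "('m::{t2_space, second_countable_topology}, 'n::finite) chart set"
    and g :: "('m, 'n) metric"
    and dV :: "'m measure"
    and e :: "nat \<Rightarrow> 'm \<Rightarrow> complex"
    and lam :: "nat \<Rightarrow> real"
    and S :: "real set"
    and f :: "'m \<Rightarrow> complex"
    and E :: "'m set"
    and L L' \<epsilon> \<epsilon>' :: real
  assumes "compact_riemannian_manifold A g"
    and "riemannian_volume A g dV"
    and "L2_orthonormal_basis dV e"
    and "\<And>j. sqrt_laplacian_eigenfunction A g (lam j) (e j)"
    and "lam 0 = 0" and "incseq lam" and "filterlim lam at_top sequentially"
    and "finite S" and "S \<subseteq> sqrt_laplacian_eigenvalues A g"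
    and "f \<in> Lp_space 2 dV" and "\<not> (AE x in dV. f x = 0)"
    and "Lp_concentrated 2 dV E L f"
    and "Lp_concentrated 2 (count_space UNIV) {j. lam j \<in> S} L' (fourier_coeff dV e f)"
    and "\<epsilon> \<in> {0..<1}" and "\<epsilon>' \<in> {0..<1}"
    and "\<epsilon> + \<epsilon>' \<le> 1"
    and "L = (1 - \<epsilon>\<^sup>2) powr (- 1 / 2)" and "L' = (1 - \<epsilon>'\<^sup>2) powr (- 1 / 2)"
  shows "ennreal ((1 - \<epsilon> - \<epsilon>')\<^sup>2)
           \<le> emeasure dV E * (SUP x. \<Sum>j\<in>{j. lam j \<in> S}. ennreal ((cmod (e j x))\<^sup>2))"
  \<comment> \<open>The measure is \<open>dV\<close>, and the equations for \<open>L\<close> and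
    \<open>L'\<close> put both concentration hypotheses into the required form.\<close>
  using L2_uncertainty_principle[of dV e "{j. lam j \<in> S}" f E \<epsilon> \<epsilon>'] assms
  by (simp add: finite_vimage_filterlim_at_top)

end
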